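(* Let $X=(\mathbb{R}^2,\|\cdot\|)$ be a two-dimensional real Banach space with $n^{(3)}(X)=0$, where $\|\cdot\|$ is a normalized absolute symmetric norm. Then there is $\beta\in[0,3]$ such that $$\|(x,y)\|=\left(x^4+2\beta x^2y^2+y^4\right)^{1/4}\qquad\text{for all }(x,y)\in\mathbb{R}^2.$$ In particular, the fourth power of the norm of $X$ is a polynomial.
   Context: A norm $\|\cdot\|$ on $\mathbb{R}^2$ is absolute if $\|(x,y)\|=\|(|x|,|y|)\|$ for all $x,y\in\mathbb{R}$, normalized if $\|(1,0)\|=\|(0,1)\|=1$, and symmetric if $\|(x,y)\|=\|(y,x)\|$ for all $x,y\in\mathbb{R}$. For a Banach space $X$, let $S_X$ be its unit sphere, $B_X$ its closed unit ball, $X^*$ its dual, and $\Pi(X)=\{(x,x^* )\in S_X\times S_{X^*} : x^*(x)=1\}$. A continuous $k$-homogeneous polynomial on $X$ is a map $P:X\to X$ of the form $P(x)=A(x,\ldots,x)$ with $A:X\times\cdots\times X\to X$ a continuous $k$-linear map; $\mathcal{P}(^kX;X)$ is the space of all of them, normed by $\|P\|=\sup\{\|P(x)\| : x\in B_X\}$. The numerical radius of $P$ is $v(P)=\sup\{|x^*(P(x))| : (x,x^* )\in\Pi(X)\}$. The polynomial numerical index of order $k$ of $X$ is $n^{(k)}(X)=\inf\{v(P) : P\in\mathcal{P}(^kX;X),\ \|P\|=1\}$. *)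

theory Defs
  imports "HOL-Analysis.Analysis"
begin

text \<open>
  The norm is an explicit function on a real vector space rather than the type-class norm, because
  the statement quantifies over norms on the plane and the type \<open>real \<times> real\<close>
  already carries the Euclidean one. All notions below (topology, dual, numerical radius) are
  taken with respect to that function.
\<close>

definition is_norm :: "('a::real_vector \<Rightarrow> real) \<Rightarrow> bool" where
  "is_norm N \<longleftrightarrow>
     (\<forall>x. 0 \<le> N x) \<and>
     (\<forall>x. N x = 0 \<longleftrightarrow> x = 0) \<and>
     (\<forall>c x. N (c *\<^sub>R x) = \<bar>c\<bar> * N x) \<and>
     (\<forall>x y. N (x + y) \<le> N x + N y)"

definition norm_topology :: "('a::real_vector \<Rightarrow> real) \<Rightarrow> 'a topology" where
  "norm_topology N = Metric_space.mtopology UNIV (\<lambda>x y. N (x - y))"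

definition unit_sphere :: "('a::real_vector \<Rightarrow> real) \<Rightarrow> 'a set" where
  "unit_sphere N = {x. N x = 1}"

definition unit_ball :: "('a::real_vector \<Rightarrow> real) \<Rightarrow> 'a set" where
  "unit_ball N = {x. N x \<le> 1}"

definition dual_space :: "('a::real_vector \<Rightarrow> real) \<Rightarrow> ('a \<Rightarrow> real) set" where
  "dual_space N = {f. linear f \<and> continuous_map (norm_topology N) euclideanreal f}"

definition dual_norm :: "('a::real_vector \<Rightarrow> real) \<Rightarrow> ('a \<Rightarrow> real) \<Rightarrow> real" where
  "dual_norm N f = (SUP x\<in>unit_ball N. \<bar>f x\<bar>)"

definition dual_unit_sphere :: "('a::real_vector \<Rightarrow> real) \<Rightarrow> ('a \<Rightarrow> real) set" where
  "dual_unit_sphere N = {f \<in> dual_space N. dual_norm N f = 1}"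

definition Pi_set :: "('a::real_vector \<Rightarrow> real) \<Rightarrow> ('a \<times> ('a \<Rightarrow> real)) set" where
  "Pi_set N = {(x, f). x \<in> unit_sphere N \<and> f \<in> dual_unit_sphere N \<and> f x = 1}"

text \<open>
  The \<open>k\<close>-fold power of the space is the set of extensional functions on
  \<open>{..<k}\<close>, which is the carrier of the product topology; values of a
  \<open>k\<close>-linear map outside it are irrelevant.
\<close>

definition k_linear :: "nat \<Rightarrow> ((nat \<Rightarrow> 'a::real_vector) \<Rightarrow> 'a) \<Rightarrow> bool" where
  "k_linear k A \<longleftrightarrow>
     (\<forall>x \<in> (\<Pi>\<^sub>E i\<in>{..<k}. UNIV). \<forall>i<k. linear (\<lambda>v. A (x(i := v))))"

definition continuous_k_linear ::
    "('a::real_vector \<Rightarrow> real) \<Rightarrow> nat \<Rightarrow> ((nat \<Rightarrow> 'a) \<Rightarrow> 'a) \<Rightarrow> bool" where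
  "continuous_k_linear N k A \<longleftrightarrow>
     k_linear k A \<and>
     continuous_map (product_topology (\<lambda>i. norm_topology N) {..<k}) (norm_topology N) A"

definition hom_polynomials :: "('a::real_vector \<Rightarrow> real) \<Rightarrow> nat \<Rightarrow> ('a \<Rightarrow> 'a) set" where
  "hom_polynomials N k =
     {P. \<exists>A. continuous_k_linear N k A \<and> (\<forall>x. P x = A (\<lambda>i\<in>{..<k}. x))}"

definition polynomial_norm :: "('a::real_vector \<Rightarrow> real) \<Rightarrow> ('a \<Rightarrow> 'a) \<Rightarrow> real" where
  "polynomial_norm N P = (SUP x\<in>unit_ball N. N (P x))"

definition numerical_radius :: "('a::real_vector \<Rightarrow> real) \<Rightarrow> ('a \<Rightarrow> 'a) \<Rightarrow> real" where
  "numerical_radius N P = (SUP (x, f)\<in>Pi_set N. \<bar>f (P x)\<bar>)"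

definition polynomial_numerical_index :: "nat \<Rightarrow> ('a::real_vector \<Rightarrow> real) \<Rightarrow> real" where
  "polynomial_numerical_index k N =
     (INF P\<in>{P \<in> hom_polynomials N k. polynomial_norm N P = 1}. numerical_radius N P)"

definition absolute_norm :: "(real \<times> real \<Rightarrow> real) \<Rightarrow> bool" where
  "absolute_norm N \<longleftrightarrow> (\<forall>x y. N (x, y) = N (\<bar>x\<bar>, \<bar>y\<bar>))"

definition normalized_norm :: "(real \<times> real \<Rightarrow> real) \<Rightarrow> bool" where
  "normalized_norm N \<longleftrightarrow> N (1, 0) = 1 \<and> N (0, 1) = 1"

definition symmetric_norm :: "(real \<times> real \<Rightarrow> real) \<Rightarrow> bool" where
  "symmetric_norm N \<longleftrightarrow> (\<forall>x y. N (x, y) = N (y, x))"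

end

theory Submission
  imports Defs
begin

text \<open>
  By compactness some nonzero pair of cubic forms \<open>(p, q)\<close> has numerical radius zero: it is
  annihilated by every functional \<open>(u, v)\<close> supporting the unit ball at \<open>(x, y)\<close>. The
  symmetries of the norm reduce this to
  \<open>u * (a * x\<^sup>2 * y + b * y ^ 3) = v * (b * x ^ 3 + a * x * y\<^sup>2)\<close>, that is, the
  norm is constant along the level curves of \<open>b * x ^ 4 + 2 * a * x\<^sup>2 * y\<^sup>2 + b * y ^ 4\<close>.
  Along the line \<open>x = 1\<close> the slope \<open>v\<close> is thus a continuous function of \<open>y\<close>, so the
  profile \<open>g y = N (1, y)\<close> is differentiable and the resulting equation makes
  \<open>g ^ 4\<close> proportional to the quartic. The bounds on \<open>\<beta> = a / b\<close> come from
  \<open>g \<ge> 1\<close> and from the triangle inequality near the diagonal.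
\<close>

subsection \<open>Cubic forms\<close>

text \<open>Binary cubic forms are encoded by coefficient vectors in \<open>real ^ 4\<close>, so
  that compactness of Euclidean balls applies to pairs of them.\<close>

definition cubic :: "real ^ 4 \<Rightarrow> real \<Rightarrow> real \<Rightarrow> real" where
  "cubic c x y = c $ 1 * x ^ 3 + c $ 2 * x\<^sup>2 * y + c $ 3 * x * y\<^sup>2 + c $ 4 * y ^ 3"

lemma cubic_scale: "cubic c (r * x) (r * y) = r ^ 3 * cubic c x y"
  by (simp add: cubic_def power2_eq_square power3_eq_cube algebra_simps)

lemma abs_cubic_le:
  assumes "\<bar>x\<bar> \<le> 1" "\<bar>y\<bar> \<le> 1"
  shows "\<bar>cubic c x y\<bar> \<le> (\<Sum>i\<in>UNIV. \<bar>c $ i\<bar>)"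
proof -
  have le: "\<bar>a * s\<bar> \<le> \<bar>a\<bar>" if "\<bar>s\<bar> \<le> 1" for a s :: real
    using mult_left_mono[OF that, of "\<bar>a\<bar>"] by (simp add: abs_mult)
  have "\<bar>x ^ 3\<bar> \<le> 1" "\<bar>x\<^sup>2 * y\<bar> \<le> 1" "\<bar>x * y\<^sup>2\<bar> \<le> 1" "\<bar>y ^ 3\<bar> \<le> 1"
    unfolding abs_mult power_abs
    by (intro mult_le_one power_le_one zero_le_power abs_ge_zero assms)+
  then have "\<bar>c $ 1 * x ^ 3\<bar> \<le> \<bar>c $ 1\<bar>" "\<bar>c $ 2 * (x\<^sup>2 * y)\<bar> \<le> \<bar>c $ 2\<bar>"
    "\<bar>c $ 3 * (x * y\<^sup>2)\<bar> \<le> \<bar>c $ 3\<bar>" "\<bar>c $ 4 * y ^ 3\<bar> \<le> \<bar>c $ 4\<bar>"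
    by (simp_all only: le)
  then show ?thesis
    unfolding cubic_def sum_4 mult.assoc by linarith
qed

text \<open>Four points of the l1 ball determine the form: the axis points give \<open>c $ 1\<close>
  and \<open>c $ 4\<close>, and the two diagonal values, times 8, are the sum and the difference of
  \<open>c $ 1 + c $ 3\<close> and \<open>c $ 2 + c $ 4\<close>. The constant 30 is generous; what
  counts is that it is uniform.\<close>

lemma norm_cubic_coeffs_le:
  assumes "\<And>x y. \<bar>x\<bar> + \<bar>y\<bar> \<le> 1 \<Longrightarrow> \<bar>cubic c x y\<bar> \<le> 1"
  shows "norm c \<le> 30"
proof -
  have "\<bar>cubic c 1 0\<bar> \<le> 1" "\<bar>cubic c 0 1\<bar> \<le> 1"
    "\<bar>cubic c (1/2) (1/2)\<bar> \<le> 1" "\<bar>cubic c (1/2) (-1/2)\<bar> \<le> 1"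
    by (rule assms; simp)+
  then have "\<bar>c $ 1\<bar> + \<bar>c $ 2\<bar> + \<bar>c $ 3\<bar> + \<bar>c $ 4\<bar> \<le> 30"
    unfolding cubic_def by (simp add: power2_eq_square power3_eq_cube)
  then show ?thesis
    using norm_le_l1_cart[of c] by (simp add: sum_4)
qed

text \<open>Trilinearity expands \<open>A\<close> along the standard basis, and each coordinate of
  the result is a binary cubic form.\<close>

lemma hom_polynomials_3_cubic:
  fixes N :: "real \<times> real \<Rightarrow> real"
  assumes "P \<in> hom_polynomials N 3"
  obtains c d where "\<And>x y. P (x, y) = (cubic c x y, cubic d x y)"
proof -
  obtain A where A: "k_linear 3 A" and P: "\<And>x. P x = A (\<lambda>i\<in>{..<3}. x)"
    using that assms unfolding hom_polynomials_def continuous_k_linear_def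
    by (elim CollectE exE conjE) blast
  \<comment> \<open>Restricting to \<open>{..<3}\<close> places the tuples in the extensional
    carrier over which \<open>k_linear\<close> quantifies.\<close>
  define t where "t u v w = (\<lambda>i\<in>{..<3::nat}. if i = 0 then u else if i = 1 then v else w)"
    for u v w :: "real \<times> real"
  have lin: "linear (\<lambda>z. A ((t u v w)(i := z)))" if "i < 3" for u v w i
    by (rule A[unfolded k_linear_def, rule_format, OF _ that]) (simp add: t_def)
  have upd: "(t u v w)(0 := z) = t z v w" "(t u v w)(1 := z) = t u z w"
    "(t u v w)(2 := z) = t u v z" for u v w z
    by (auto simp: t_def fun_eq_iff)
  define T where "T u v w = A (t u v w)" for u v w
  have "linear (\<lambda>z. T z v w)" "linear (\<lambda>z. T u z w)" "linear (\<lambda>z. T u v z)" for u v w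
    using lin[of 0 u v w] lin[of 1 u v w] lin[of 2 u v w] by (simp_all only: upd T_def)
  note add = this[THEN linear_add] and scale = this[THEN linear_scale]
  have expand: "T (x *\<^sub>R e + y *\<^sub>R f) (x *\<^sub>R e + y *\<^sub>R f) (x *\<^sub>R e + y *\<^sub>R f) =
      x ^ 3 *\<^sub>R T e e e + (x\<^sup>2 * y) *\<^sub>R (T e e f + T e f e + T f e e)
      + (x * y\<^sup>2) *\<^sub>R (T e f f + T f e f + T f f e) + y ^ 3 *\<^sub>R T f f f" for x y e f
    by (simp add: add scale power2_eq_square power3_eq_cube scaleR_add_right ac_simps)
  let ?e = "(1, 0)" and ?f = "(0, 1)"
  have eq: "P (x, y) = x ^ 3 *\<^sub>R T ?e ?e ?e
      + (x\<^sup>2 * y) *\<^sub>R (T ?e ?e ?f + T ?e ?f ?e + T ?f ?e ?e)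
      + (x * y\<^sup>2) *\<^sub>R (T ?e ?f ?f + T ?f ?e ?f + T ?f ?f ?e) + y ^ 3 *\<^sub>R T ?f ?f ?f" for x y
  proof -
    have "P (x, y) = T (x, y) (x, y) (x, y)"
      unfolding P T_def t_def by (rule arg_cong[of _ _ A]) auto
    moreover have "(x, y) = x *\<^sub>R ?e + y *\<^sub>R ?f"
      by simp
    ultimately show ?thesis
      using expand[of x ?e y ?f] by (simp only:)
  qed
  define V where "V \<pi> = (\<chi> i::4. if i = 1 then \<pi> (T ?e ?e ?e)
      else if i = 2 then \<pi> (T ?e ?e ?f + T ?e ?f ?e + T ?f ?e ?e)
      else if i = 3 then \<pi> (T ?e ?f ?f + T ?f ?e ?f + T ?f ?f ?e)
      else \<pi> (T ?f ?f ?f))" for \<pi> :: "real \<times> real \<Rightarrow> real"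
  have "P (x, y) = (cubic (V fst) x y, cubic (V snd) x y)" for x y
    unfolding eq cubic_def V_def by (simp add: prod_eq_iff algebra_simps)
  then show ?thesis
    using that by blast
qed

subsection \<open>Absolute normalized norms and their support functionals\<close>

locale absolute_normalized =
  fixes N :: "real \<times> real \<Rightarrow> real"
  assumes is_norm: "is_norm N"
    and absolute: "absolute_norm N"
    and normalized: "normalized_norm N"
begin

section \<open>Elementary estimates and the topology of the norm\<close>

lemma nonneg: "0 \<le> N p"
  and eq_0_iff: "N p = 0 \<longleftrightarrow> p = 0"
  and scale: "N (r *\<^sub>R p) = \<bar>r\<bar> * N p"
  and triangle: "N (p + q) \<le> N p + N q"
  using is_norm unfolding is_norm_def by blast+

lemma scale': "N (r * x, r * y) = \<bar>r\<bar> * N (x, y)"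
  using scale[of r "(x, y)"] by simp

lemma triangle': "N (x + s, y + t) \<le> N (x, y) + N (s, t)"
  using triangle[of "(x, y)" "(s, t)"] by simp

lemma abs_eq: "N (\<bar>x\<bar>, \<bar>y\<bar>) = N (x, y)"
  using absolute unfolding absolute_norm_def by metis

lemma uminus_snd: "N (x, - y) = N (x, y)"
  by (metis abs_eq abs_minus_cancel)

lemma axes: "N (x, 0) = \<bar>x\<bar>" "N (0, y) = \<bar>y\<bar>"
  using scale'[of x 1 0] scale'[of y 0 1] normalized by (auto simp: normalized_norm_def)

text \<open>A point and its mirror image have equal norm, and their sum lies on the axis.\<close>

lemma abs_fst_le: "\<bar>x\<bar> \<le> N (x, y)"
proof -
  have "N (x + x, y + - y) \<le> N (x, y) + N (x, - y)"
    by (rule triangle')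
  then show ?thesis
    by (simp add: axes uminus_snd)
qed

lemma abs_snd_le: "\<bar>y\<bar> \<le> N (x, y)"
proof -
  have "N (x + - x, y + y) \<le> N (x, y) + N (- x, y)"
    by (rule triangle')
  moreover have "N (- x, y) = N (x, y)"
    by (metis abs_eq abs_minus_cancel)
  ultimately show ?thesis
    by (simp add: axes)
qed

lemma le_l1: "N (x, y) \<le> \<bar>x\<bar> + \<bar>y\<bar>"
  using triangle'[of x 0 0 y] by (simp add: axes)

text \<open>\<open>N\<close> lies between the maximum norm and the l1 norm, hence is equivalent to
  the Euclidean norm with factor 2 both ways. Continuity in the definitions thus becomes Euclidean
  continuity.\<close>

lemma norm_topology_eq: "norm_topology N = euclidean"
proof -
  have ms: "Metric_space UNIV (\<lambda>x y. N (x - y))"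
  proof
    show "N (x - y) = N (y - x)" for x y
      using scale[of "-1" "x - y"] by simp
    show "N (x - z) \<le> N (x - y) + N (y - z)" for x y z
      using triangle[of "x - y" "y - z"] by simp
  qed (auto simp: nonneg eq_0_iff)
  have up: "N p \<le> 2 * norm p" and low: "norm p \<le> 2 * N p" for p
  proof -
    obtain x y where p: "p = (x, y)" by (cases p)
    have "\<bar>x\<bar> \<le> norm p" "\<bar>y\<bar> \<le> norm p"
      unfolding p using norm_fst_le[of x y] norm_snd_le[of y x] by simp_all
    then show "N p \<le> 2 * norm p"
      using le_l1[of x y] p by simp
    have "norm p \<le> \<bar>x\<bar> + \<bar>y\<bar>"
      unfolding p using norm_Pair_le[of x y] by simp
    then show "norm p \<le> 2 * N p"
      using abs_fst_le[of x y] abs_snd_le[of y x] p by simp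
  qed
  have "openin (norm_topology N) U \<longleftrightarrow> open U" for U
  proof -
    have "(\<exists>r>0. \<forall>y. N (x - y) < r \<longrightarrow> y \<in> U) \<longleftrightarrow> (\<exists>r>0. \<forall>y. norm (x - y) < r \<longrightarrow> y \<in> U)" for x
    proof safe
      fix r assume "r > 0" "\<forall>y. N (x - y) < r \<longrightarrow> y \<in> U"
      then show "\<exists>r>0. \<forall>y. norm (x - y) < r \<longrightarrow> y \<in> U"
        by (intro exI[of _ "r / 2"]) (smt (verit) up field_sum_of_halves)
    next
      fix r assume "r > 0" "\<forall>y. norm (x - y) < r \<longrightarrow> y \<in> U"
      then show "\<exists>r>0. \<forall>y. N (x - y) < r \<longrightarrow> y \<in> U"
        by (intro exI[of _ "r / 2"]) (smt (verit) low field_sum_of_halves)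
    qed
    then show ?thesis
      unfolding norm_topology_def Metric_space.openin_mtopology[OF ms] open_contains_ball
        Metric_space.mball_def[OF ms] subset_iff mem_ball dist_norm mem_Collect_eq
      by (simp only: Ball_def UNIV_I simp_thms)
  qed
  then show ?thesis
    by (simp add: topology_eq)
qed

section \<open>Support functionals\<close>

text \<open>The pair \<open>(u, v)\<close> represents a functional of dual norm at most 1 that norms
  \<open>(x, y)\<close>. The point is not normalized, so that points \<open>(1, t)\<close> can be
  used directly.\<close>

definition supports :: "real \<Rightarrow> real \<Rightarrow> real \<Rightarrow> real \<Rightarrow> bool" where
  "supports u v x y \<longleftrightarrow> (\<forall>s t. u * s + v * t \<le> N (s, t)) \<and> u * x + v * y = N (x, y)"

lemma supportsD: "supports u v x y \<Longrightarrow> u * s + v * t \<le> N (s, t)"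
  by (simp add: supports_def)

lemma supports_eq: "supports u v x y \<Longrightarrow> u * x + v * y = N (x, y)"
  by (simp add: supports_def)

lemma supports_uminus: "supports u v x y \<Longrightarrow> supports u (- v) x (- y)"
  unfolding supports_def
  by (metis (no_types, opaque_lifting) minus_minus minus_mult_left minus_mult_right uminus_snd)

lemma supports_1_0: "supports 1 0 1 0"
  using abs_fst_le by (auto simp: supports_def axes abs_le_iff)

text \<open>A subgradient of the convex function \<open>N (1, s)\<close> at \<open>t\<close>
  supplies \<open>v\<close>. Once \<open>u\<close> and \<open>v\<close> are nonnegative,
  absoluteness reduces the global inequality to the first quadrant, and homogeneity to the line
  \<open>x = 1\<close>.\<close>

lemma supports_exists:
  assumes "t > 0"
  obtains u v where "supports u v 1 t"
proof -
  have conv: "convex_on UNIV (\<lambda>s. N (1, s))"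
  proof (rule convex_onI)
    fix r x y :: real assume r: "0 < r" "r < 1"
    have "N ((1 - r) *\<^sub>R (1, x) + r *\<^sub>R (1, y)) \<le> N ((1 - r) *\<^sub>R (1, x)) + N (r *\<^sub>R (1, y))"
      by (rule triangle)
    then show "N (1, (1 - r) *\<^sub>R x + r *\<^sub>R y) \<le> (1 - r) * N (1, x) + r * N (1, y)"
      unfolding scale using r by simp
  qed simp
  \<comment> \<open>The right derivative of the profile at \<open>t\<close>; \<open>u\<close> is
    then the intercept of the tangent line.\<close>
  define v where "v = Inf ((\<lambda>s. (N (1, t) - N (1, s)) / (t - s)) ` ({t<..} \<inter> UNIV))"
  define u where "u = N (1, t) - v * t"
  have sub: "u + v * s \<le> N (1, s)" for s
    using convex_le_Inf_differential[OF conv, of t s]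
    unfolding u_def v_def by (simp add: algebra_simps)
  have "v * t \<ge> 0"
    using sub[of "- t"] unfolding u_def uminus_snd by (simp add: mult.commute)
  then have v0: "v \<ge> 0"
    using assms by (simp add: zero_le_mult_iff mult.commute)
  have v1: "v \<le> 1"
    using sub[of "t + 1"] triangle'[of 1 0 t 1] axes(2)[of 1] by (simp add: u_def algebra_simps)
  have "v * t \<le> t"
    using mult_right_mono[OF v1, of t] assms by simp
  then have u0: "u \<ge> 0"
    using abs_snd_le[of t 1] assms unfolding u_def by linarith
  have "u * s + v * w \<le> N (s, w)" for s w
  proof -
    have "u * s + v * w \<le> u * \<bar>s\<bar> + v * \<bar>w\<bar>"
      using u0 v0 by (intro add_mono mult_left_mono) auto
    also have "\<dots> \<le> N (\<bar>s\<bar>, \<bar>w\<bar>)"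
    proof (cases "s = 0")
      case True
      then show ?thesis using mult_right_mono[OF v1, of "\<bar>w\<bar>"] by (simp add: axes)
    next
      case False
      then have "u * \<bar>s\<bar> + v * \<bar>w\<bar> = \<bar>s\<bar> * (u + v * (\<bar>w\<bar> / \<bar>s\<bar>))"
        by (simp add: field_simps)
      also have "\<dots> \<le> \<bar>s\<bar> * N (1, \<bar>w\<bar> / \<bar>s\<bar>)"
        by (intro mult_left_mono sub) simp
      also have "\<dots> = N (\<bar>s\<bar>, \<bar>w\<bar>)"
        using False scale'[of "\<bar>s\<bar>" 1 "\<bar>w\<bar> / \<bar>s\<bar>"] by simp
      finally show ?thesis .
    qed
    finally show ?thesis by (simp add: abs_eq)
  qed
  then have "supports u v 1 t"
    by (simp add: supports_def u_def)
  then show ?thesis by (rule that)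
qed

lemma supports_Pi_set:
  assumes "supports u v x y" "N (x, y) = 1"
  shows "((x, y), \<lambda>p. u * fst p + v * snd p) \<in> Pi_set N"
proof -
  define f where "f p = u * fst p + v * snd p" for p
  have lin: "linear f"
    unfolding f_def by (rule linearI) (auto simp: algebra_simps)
  have xy: "f (x, y) = 1"
    using supports_eq[OF assms(1)] assms(2) by (simp add: f_def)
  have le: "f p \<le> N p" for p
    using supportsD[OF assms(1), of "fst p" "snd p"] by (simp add: f_def)
  have abs_le: "\<bar>f p\<bar> \<le> N p" for p
    using le[of p] le[of "- p"] linear_neg[OF lin, of p] scale[of "-1" p] by simp
  have "continuous_map (norm_topology N) euclideanreal f"
    using lin by (simp add: norm_topology_eq linear_continuous_on linear_conv_bounded_linear)
  moreover have "dual_norm N f = 1"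
    unfolding dual_norm_def
  proof (rule cSup_eq_maximum)
    show "1 \<in> (\<lambda>x. \<bar>f x\<bar>) ` unit_ball N"
      using xy assms(2) by (auto simp: unit_ball_def intro!: image_eqI[of _ _ "(x, y)"])
    show "r \<le> 1" if "r \<in> (\<lambda>x. \<bar>f x\<bar>) ` unit_ball N" for r
      using that abs_le by (auto simp: unit_ball_def intro: order_trans)
  qed
  ultimately have "((x, y), f) \<in> Pi_set N"
    using lin xy assms(2)
    by (simp add: Pi_set_def unit_sphere_def dual_unit_sphere_def dual_space_def)
  then show ?thesis
    by (simp add: f_def[abs_def])
qed

text \<open>A real supremum bounds its set only if the set is bounded above, so boundedness of
  \<open>f\<close> on the ball is derived first from its values on the basis.\<close>

lemma dual_unit_sphere_le:
  assumes "f \<in> dual_unit_sphere N"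
  shows "\<bar>f p\<bar> \<le> N p"
proof (cases "p = 0")
  case True
  then show ?thesis
    using assms by (simp add: dual_unit_sphere_def dual_space_def linear_0 nonneg)
next
  case False
  have lin: "linear f" and norm1: "(SUP x\<in>unit_ball N. \<bar>f x\<bar>) = 1"
    using assms by (auto simp: dual_unit_sphere_def dual_space_def dual_norm_def)
  have "bdd_above ((\<lambda>x. \<bar>f x\<bar>) ` unit_ball N)"
  proof (rule bdd_aboveI2)
    fix z assume z: "z \<in> unit_ball N"
    obtain x y where xy: "z = (x, y)" by (cases z)
    have "\<bar>x\<bar> \<le> 1" "\<bar>y\<bar> \<le> 1"
      using z abs_fst_le[of x y] abs_snd_le[of y x] by (simp_all add: xy unit_ball_def)
    then have "\<bar>x\<bar> * \<bar>f (1, 0)\<bar> \<le> \<bar>f (1, 0)\<bar>" "\<bar>y\<bar> * \<bar>f (0, 1)\<bar> \<le> \<bar>f (0, 1)\<bar>"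
      by (simp_all add: mult_left_le_one_le)
    moreover have "f z = x * f (1, 0) + y * f (0, 1)"
      using linear_add[OF lin, of "x *\<^sub>R (1, 0)" "y *\<^sub>R (0, 1)"]
        linear_scale[OF lin, of x "(1, 0)"] linear_scale[OF lin, of y "(0, 1)"]
      by (simp add: xy)
    ultimately show "\<bar>f z\<bar> \<le> \<bar>f (1, 0)\<bar> + \<bar>f (0, 1)\<bar>"
      using abs_triangle_ineq[of "x * f (1, 0)" "y * f (0, 1)"] by (simp add: abs_mult)
  qed
  moreover have pos: "N p > 0"
    using False nonneg[of p] eq_0_iff[of p] by simp
  then have "(1 / N p) *\<^sub>R p \<in> unit_ball N"
    by (simp add: unit_ball_def scale)
  ultimately have "\<bar>f ((1 / N p) *\<^sub>R p)\<bar> \<le> 1"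
    using norm1 by (metis (no_types, lifting) cSUP_upper)
  then show ?thesis
    using pos by (simp add: linear_scale[OF lin] abs_mult divide_simps)
qed

section \<open>Bounds for the suprema and for the coefficients\<close>

lemma N_cubic_le:
  assumes "(x, y) \<in> unit_ball N"
  shows "N (cubic c x y, cubic d x y) \<le> (\<Sum>i\<in>UNIV. \<bar>c $ i\<bar>) + (\<Sum>i\<in>UNIV. \<bar>d $ i\<bar>)"
proof -
  have "\<bar>x\<bar> \<le> 1" "\<bar>y\<bar> \<le> 1"
    using assms abs_fst_le[of x y] abs_snd_le[of y x] by (simp_all add: unit_ball_def)
  then show ?thesis
    using abs_cubic_le[of x y c] abs_cubic_le[of x y d] le_l1[of "cubic c x y" "cubic d x y"]
    by linarith
qed

lemma numerical_radius_upper: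
  assumes P: "P \<in> hom_polynomials N 3" and "(z, f) \<in> Pi_set N"
  shows "\<bar>f (P z)\<bar> \<le> numerical_radius N P"
proof -
  obtain c d where cd: "\<And>x y. P (x, y) = (cubic c x y, cubic d x y)"
    using hom_polynomials_3_cubic[OF P] by blast
  have "bdd_above ((\<lambda>(x, f). \<bar>f (P x)\<bar>) ` Pi_set N)"
  proof (rule bdd_aboveI2)
    fix zf assume "zf \<in> Pi_set N"
    moreover obtain x y f where zf: "zf = ((x, y), f)" by (metis surj_pair)
    ultimately have "(x, y) \<in> unit_ball N" "f \<in> dual_unit_sphere N"
      by (auto simp: Pi_set_def unit_sphere_def unit_ball_def)
    then show "(case zf of (x, f) \<Rightarrow> \<bar>f (P x)\<bar>) \<le> (\<Sum>i\<in>UNIV. \<bar>c $ i\<bar>) + (\<Sum>i\<in>UNIV. \<bar>d $ i\<bar>)"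
      using N_cubic_le[of x y c d] dual_unit_sphere_le[of f "P (x, y)"] by (simp add: zf cd)
  qed
  then show ?thesis
    unfolding numerical_radius_def using cSUP_upper[OF assms(2)] by fastforce
qed

text \<open>Normalized polynomials have coefficients in a compact set avoiding zero. The upper
  bounds come from the l1 ball, which lies inside \<open>unit_ball N\<close>.\<close>

lemma polynomial_norm_1_coeffs:
  assumes cd: "\<And>x y. P (x, y) = (cubic c x y, cubic d x y)" and norm1: "polynomial_norm N P = 1"
  shows "norm c \<le> 30" "norm d \<le> 30" "1 \<le> (\<Sum>i\<in>UNIV. \<bar>c $ i\<bar>) + (\<Sum>i\<in>UNIV. \<bar>d $ i\<bar>)"
proof -
  let ?S = "(\<Sum>i\<in>UNIV. \<bar>c $ i\<bar>) + (\<Sum>i\<in>UNIV. \<bar>d $ i\<bar>)"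
  have le: "N (P z) \<le> ?S" if "z \<in> unit_ball N" for z
    using that N_cubic_le cd by (cases z) auto
  have "(0, 0) \<in> unit_ball N"
    by (simp add: unit_ball_def axes)
  then show "1 \<le> ?S"
    unfolding norm1[symmetric] polynomial_norm_def by (intro cSUP_least le) auto
  have "bdd_above ((\<lambda>z. N (P z)) ` unit_ball N)"
    using le by (rule bdd_aboveI2)
  then have "N (P z) \<le> 1" if "z \<in> unit_ball N" for z
    using norm1 that unfolding polynomial_norm_def by (metis cSUP_upper)
  then have "N (cubic c x y, cubic d x y) \<le> 1" if "\<bar>x\<bar> + \<bar>y\<bar> \<le> 1" for x y
    using that le_l1[of x y] unfolding cd[symmetric] by (simp add: unit_ball_def)
  then have "\<bar>cubic c x y\<bar> \<le> 1" "\<bar>cubic d x y\<bar> \<le> 1" if "\<bar>x\<bar> + \<bar>y\<bar> \<le> 1" for x y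
    using that abs_fst_le abs_snd_le order_trans by blast+
  then show "norm c \<le> 30" "norm d \<le> 30"
    by (auto intro: norm_cubic_coeffs_le)
qed

text \<open>A witness that the infimum in the index is over a nonempty set, as extracting
  polynomials of small numerical radius from it requires.\<close>

lemma cube_hom_polynomial:
  defines "P \<equiv> \<lambda>z::real \<times> real. (fst z ^ 3, 0::real)"
  shows "P \<in> hom_polynomials N 3" "polynomial_norm N P = 1"
proof -
  let ?A = "\<lambda>z::nat \<Rightarrow> real \<times> real. (fst (z 0) * fst (z 1) * fst (z 2), 0::real)"
  have "linear (\<lambda>v. ?A (z(i := v)))" if "i < 3" for z and i :: nat
  proof -
    from that consider "i = 0" | "i = 1" | "i = 2" by linarith
    then show ?thesis
      by cases (auto intro!: linearI simp: algebra_simps)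
  qed
  moreover have "continuous_map (product_topology (\<lambda>i. euclidean) {..<3::nat}) euclidean ?A"
  proof -
    have "continuous_map (product_topology (\<lambda>i. euclidean) {..<3::nat}) euclidean
        (\<lambda>z. fst (z i :: real \<times> real))" if "i < 3" for i
      using continuous_map_compose[OF continuous_map_product_projection[of i "{..<3}" "\<lambda>i. euclidean"],
          of euclidean fst] that
      by (simp add: o_def continuous_on_fst continuous_on_id)
    then have "continuous_map (product_topology (\<lambda>i. euclidean) {..<3::nat})
        (prod_topology euclidean euclidean) ?A"
      by (intro continuous_map_paired[THEN iffD2] conjI continuous_map_real_mult) auto
    then show ?thesis by simp
  qed
  ultimately have "continuous_k_linear N 3 ?A"
    by (simp add: continuous_k_linear_def k_linear_def norm_topology_eq)
  moreover have "P z = ?A (\<lambda>i\<in>{..<3}. z)" for z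
    by (simp add: P_def power3_eq_cube)
  ultimately show "P \<in> hom_polynomials N 3"
    unfolding hom_polynomials_def by blast
  show "polynomial_norm N P = 1"
    unfolding polynomial_norm_def
  proof (rule cSup_eq_maximum)
    show "1 \<in> (\<lambda>z. N (P z)) ` unit_ball N"
      by (rule image_eqI[of _ _ "(1, 0)"]) (simp_all add: P_def unit_ball_def axes)
    show "r \<le> 1" if r: "r \<in> (\<lambda>z. N (P z)) ` unit_ball N" for r
    proof -
      obtain x y where "N (x, y) \<le> 1" "r = N (P (x, y))"
        using r by (auto simp: unit_ball_def)
      moreover from this have "\<bar>x\<bar> \<le> 1"
        using abs_fst_le[of x y] by simp
      ultimately show "r \<le> 1"
        by (simp add: P_def axes power_abs power_le_one)
    qed
  qed
qed

text \<open>Compactness of the set of coefficients: the infimum defining the index is attained.\<close>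

lemma polynomial_numerical_index_3_eq_0:
  assumes "polynomial_numerical_index 3 N = 0"
  obtains c d where "c \<noteq> 0 \<or> d \<noteq> 0"
    and "\<And>u v x y. supports u v x y \<Longrightarrow> u * cubic c x y + v * cubic d x y = 0"
proof -
  let ?K = "cball (0::real^4) 30 \<times> cball (0::real^4) 30"
  \<comment> \<open>Coefficient pairs that are bounded, bounded away from zero, and of pairing at
    most \<open>e\<close> with all support functionals at unit vectors. The bounds pass to
    limits.\<close>
  define Q where "Q e k \<longleftrightarrow> k \<in> ?K \<and> 1 \<le> (\<Sum>i\<in>UNIV. \<bar>fst k $ i\<bar>) + (\<Sum>i\<in>UNIV. \<bar>snd k $ i\<bar>) \<and>
      (\<forall>u v x y. supports u v x y \<and> N (x, y) = 1 \<longrightarrow>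
        \<bar>u * cubic (fst k) x y + v * cubic (snd k) x y\<bar> \<le> e)" for e :: real and k
  have "\<exists>k. Q (inverse (real (Suc n))) k" for n
  proof -
    have "Inf (numerical_radius N ` {P \<in> hom_polynomials N 3. polynomial_norm N P = 1})
        < inverse (real (Suc n))"
      using assms by (simp add: polynomial_numerical_index_def)
    then obtain P where P: "P \<in> hom_polynomials N 3" "polynomial_norm N P = 1"
        "numerical_radius N P < inverse (real (Suc n))"
      using cInf_lessD[of "numerical_radius N ` {P \<in> hom_polynomials N 3. polynomial_norm N P = 1}"]
        cube_hom_polynomial by blast
    obtain c d where cd: "\<And>x y. P (x, y) = (cubic c x y, cubic d x y)"
      using hom_polynomials_3_cubic[OF P(1)] by blast
    have "\<bar>u * cubic c x y + v * cubic d x y\<bar> \<le> inverse (real (Suc n))"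
      if "supports u v x y" "N (x, y) = 1" for u v x y
      using numerical_radius_upper[OF P(1) supports_Pi_set[OF that]] P(3) by (simp add: cd)
    then have "Q (inverse (real (Suc n))) (c, d)"
      using polynomial_norm_1_coeffs[OF cd P(2)] by (simp add: Q_def)
    then show ?thesis ..
  qed
  then obtain k where k: "\<And>n. Q (inverse (real (Suc n))) (k n)"
    by metis
  have "compact ?K"
    by (intro compact_Times compact_cball)
  moreover have "k n \<in> ?K" for n
    using k[of n] by (simp add: Q_def)
  ultimately obtain l r where r: "strict_mono (r :: nat \<Rightarrow> nat)" and lim: "(k \<circ> r) \<longlonglongrightarrow> l"
    unfolding compact_def by metis
  have fs: "(\<lambda>n. fst (k (r n))) \<longlonglongrightarrow> fst l" "(\<lambda>n. snd (k (r n))) \<longlonglongrightarrow> snd l"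
    using lim by (auto intro: tendsto_fst tendsto_snd simp: o_def)
  have "1 \<le> (\<Sum>i\<in>UNIV. \<bar>fst l $ i\<bar>) + (\<Sum>i\<in>UNIV. \<bar>snd l $ i\<bar>)"
  proof (rule tendsto_lowerbound)
    show "(\<lambda>n. (\<Sum>i\<in>UNIV. \<bar>fst (k (r n)) $ i\<bar>) + (\<Sum>i\<in>UNIV. \<bar>snd (k (r n)) $ i\<bar>))
        \<longlonglongrightarrow> (\<Sum>i\<in>UNIV. \<bar>fst l $ i\<bar>) + (\<Sum>i\<in>UNIV. \<bar>snd l $ i\<bar>)"
      by (intro tendsto_intros fs)
    show "\<forall>\<^sub>F n in sequentially. 1 \<le> (\<Sum>i\<in>UNIV. \<bar>fst (k (r n)) $ i\<bar>) + (\<Sum>i\<in>UNIV. \<bar>snd (k (r n)) $ i\<bar>)"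
      using k by (auto simp: Q_def)
  qed simp
  then have ne: "fst l \<noteq> 0 \<or> snd l \<noteq> 0"
    by auto
  have unit: "u * cubic (fst l) x y + v * cubic (snd l) x y = 0"
    if "supports u v x y" "N (x, y) = 1" for u v x y
  proof -
    have "(\<lambda>n. u * cubic (fst (k (r n))) x y + v * cubic (snd (k (r n))) x y)
        \<longlonglongrightarrow> u * cubic (fst l) x y + v * cubic (snd l) x y"
      unfolding cubic_def by (intro tendsto_intros fs)
    moreover have "(\<lambda>n. u * cubic (fst (k (r n))) x y + v * cubic (snd (k (r n))) x y) \<longlonglongrightarrow> 0"
    proof (rule Lim_null_comparison)
      show "(\<lambda>n. inverse (real (Suc (r n)))) \<longlonglongrightarrow> 0"
        using LIMSEQ_subseq_LIMSEQ[OF LIMSEQ_inverse_real_of_nat r] by (simp add: o_def)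
      show "\<forall>\<^sub>F n in sequentially. norm (u * cubic (fst (k (r n))) x y + v * cubic (snd (k (r n))) x y)
          \<le> inverse (real (Suc (r n)))"
        using k that by (simp add: Q_def)
    qed
    ultimately show ?thesis
      using LIMSEQ_unique by blast
  qed
  \<comment> \<open>Homogeneity of degree 3 carries the identity from the unit sphere to all nonzero
    points.\<close>
  have "u * cubic (fst l) x y + v * cubic (snd l) x y = 0" if "supports u v x y" for u v x y
  proof (cases "(x, y) = 0")
    case True
    then show ?thesis by (simp add: cubic_def zero_prod_def)
  next
    case False
    define m where "m = inverse (N (x, y))"
    have pos: "N (x, y) > 0"
      using False nonneg[of "(x, y)"] eq_0_iff[of "(x, y)"] by simp
    then have m: "m > 0" "m * N (x, y) = 1"
      by (simp_all add: m_def)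
    then have N1: "N (m * x, m * y) = 1"
      by (simp add: scale')
    moreover have "u * (m * x) + v * (m * y) = m * (u * x + v * y)"
      by (simp add: algebra_simps)
    ultimately have "supports u v (m * x) (m * y)"
      using that m by (simp add: supports_def)
    from unit[OF this N1] have "m ^ 3 * (u * cubic (fst l) x y + v * cubic (snd l) x y) = 0"
      by (simp add: cubic_scale algebra_simps)
    then show ?thesis using m by simp
  qed
  with ne show ?thesis by (rule that)
qed

end

subsection \<open>The equation for symmetric norms\<close>

locale symmetric_absolute_normalized = absolute_normalized +
  assumes symmetric: "symmetric_norm N"
begin

lemma swap: "N (y, x) = N (x, y)"
  using symmetric unfolding symmetric_norm_def by blast

lemma supports_swap: "supports u v x y \<Longrightarrow> supports v u y x"
  unfolding supports_def by (metis add.commute swap)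

text \<open>Averaging \<open>(s, t)\<close> with \<open>(t, s)\<close> projects onto the diagonal
  without increasing the norm.\<close>

lemma supports_diag: "supports (N (1, 1) / 2) (N (1, 1) / 2) 1 1"
proof -
  have "N (1, 1) / 2 * s + N (1, 1) / 2 * t \<le> N (s, t)" for s t
  proof -
    have "(s + t) * N (1, 1) \<le> N (s + t, s + t)"
      using scale'[of "s + t" 1 1] nonneg[of "(1, 1)"] by (simp add: mult_right_mono)
    also have "\<dots> \<le> 2 * N (s, t)"
      using triangle'[of s t t s] swap[of s t] by (simp add: add.commute)
    finally show ?thesis by (simp add: algebra_simps)
  qed
  then show ?thesis by (simp add: supports_def)
qed

text \<open>
  The symmetries of the square act on support pairs, so each isotypic component of the pair
  \<open>(cubic c, cubic d)\<close> satisfies the same equations. All components but one force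
  \<open>u * t = v\<close>, which is the case \<open>a = b\<close> (the Euclidean norm).
\<close>

lemma support_equation:
  assumes "polynomial_numerical_index 3 N = 0"
  obtains a b where "a \<noteq> 0 \<or> b \<noteq> 0"
    and "\<And>u v t. 0 < t \<Longrightarrow> t < 1 \<Longrightarrow> supports u v 1 t \<Longrightarrow> u * (a * t + b * t ^ 3) = v * (b + a * t\<^sup>2)"
proof -
  obtain c d where ne: "c \<noteq> 0 \<or> d \<noteq> 0"
    and eq: "\<And>u v x y. supports u v x y \<Longrightarrow> u * cubic c x y + v * cubic d x y = 0"
    using polynomial_numerical_index_3_eq_0[OF assms] by blast
  \<comment> \<open>Half the sum and half the difference of the equation and its image under
    \<open>y\<close> to \<open>-y\<close>.\<close>
  have even: "u * (c $ 1 * x ^ 3 + c $ 3 * x * y\<^sup>2) + v * (d $ 2 * x\<^sup>2 * y + d $ 4 * y ^ 3) = 0"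
    and odd: "u * (c $ 2 * x\<^sup>2 * y + c $ 4 * y ^ 3) + v * (d $ 1 * x ^ 3 + d $ 3 * x * y\<^sup>2) = 0"
    if "supports u v x y" for u v x y
    using eq[OF that] eq[OF supports_uminus[OF that]]
    by (simp_all add: cubic_def algebra_simps)
  have c1: "c $ 1 = 0" and d4: "d $ 4 = 0"
    using even[OF supports_1_0] even[OF supports_swap[OF supports_1_0]] by simp_all
  have "N (1, 1) \<noteq> 0"
    by (simp add: eq_0_iff zero_prod_def)
  moreover have "N (1, 1) * (c $ 3 + d $ 2) = 0" "N (1, 1) * (c $ 2 + c $ 4 + d $ 1 + d $ 3) = 0"
    using even[OF supports_diag] odd[OF supports_diag]
    by (simp_all add: c1 d4 distrib_left)
  ultimately have d2: "d $ 2 = - c $ 3" and sum0: "c $ 2 + c $ 4 + d $ 1 + d $ 3 = 0"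
    by simp_all
  show ?thesis
  proof (cases "c $ 3 = 0 \<and> c $ 2 + d $ 3 = 0")
    case False
    have "u * t = v" if t: "0 < t" "t < 1" and uv: "supports u v 1 t" for u v t
    proof (cases "c $ 3 = 0")
      case True
      \<comment> \<open>The odd equation at \<open>(1, t)\<close> is added to the one at the swapped
        point \<open>(t, 1)\<close>; \<open>sum0\<close> then produces the factor
        \<open>1 - t^2\<close>.\<close>
      have "(c $ 2 + d $ 3) * (1 - t\<^sup>2) * (u * t - v) = 0"
      proof -
        have c4: "c $ 4 = - (c $ 2) - d $ 1 - d $ 3"
          using sum0 by linarith
        show ?thesis
          using odd[OF uv] odd[OF supports_swap[OF uv]] unfolding c4
          by (simp add: power2_eq_square power3_eq_cube) algebra
      qed
      moreover have "t\<^sup>2 \<noteq> 1"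
        using t by (simp add: power2_eq_1_iff)
      ultimately show ?thesis
        using False True by simp
    next
      case False
      have "c $ 3 * t * (u * t - v) = 0"
        using even[OF uv] by (simp add: c1 d4 d2 power2_eq_square algebra_simps)
      then show ?thesis
        using False t by simp
    qed
    then have "u * (1 * t + 1 * t ^ 3) = v * (1 + 1 * t\<^sup>2)"
      if "0 < t" "t < 1" "supports u v 1 t" for u v t
      using that by (metis (no_types) distrib_left mult.assoc mult.right_neutral mult_1
          power2_eq_square power3_eq_cube)
    then show ?thesis
      using that[of 1 1] by simp
  next
    case True
    then have d3: "d $ 3 = - c $ 2" and d1: "d $ 1 = - c $ 4"
      using sum0 by auto
    have "c $ 2 \<noteq> 0 \<or> c $ 4 \<noteq> 0"
      using ne True by (auto simp: vec_eq_iff forall_4 c1 d1 d2 d3 d4)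
    moreover have "u * (c $ 2 * t + c $ 4 * t ^ 3) = v * (c $ 4 + c $ 2 * t\<^sup>2)"
      if "supports u v 1 t" for u v t
      using odd[OF that] by (simp add: d1 d3 algebra_simps)
    ultimately show ?thesis
      using that by blast
  qed
qed

section \<open>The differential equation of the profile\<close>

text \<open>Substituting \<open>u = g t - v * t\<close> turns the support equation into
  \<open>4 * h * g' = h' * g\<close> with \<open>h t = 1 + 2 * \<beta> * t^2 + t^4\<close>, so
  \<open>g^4 / h\<close> is constant, with value 1 at 0.\<close>

lemma profile_quartic:
  assumes "polynomial_numerical_index 3 N = 0"
  obtains \<beta> where "\<And>t. 0 \<le> t \<Longrightarrow> t \<le> 1 \<Longrightarrow> N (1, t) ^ 4 = 1 + 2 * \<beta> * t\<^sup>2 + t ^ 4"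
proof -
  obtain a b where ab: "a \<noteq> 0 \<or> b \<noteq> 0"
    and eq: "\<And>u v t. 0 < t \<Longrightarrow> t < 1 \<Longrightarrow> supports u v 1 t \<Longrightarrow>
        u * (a * t + b * t ^ 3) = v * (b + a * t\<^sup>2)"
    using support_equation[OF assms] by blast
  define g where "g t = N (1, t)" for t
  have b: "b \<noteq> 0"
  proof
    assume b0: "b = 0"
    \<comment> \<open>With \<open>b = 0\<close> the equation reads \<open>u = v * t\<close>, so
      \<open>2 * v * t = g t\<close> is at least 1; as \<open>v\<close> is at most 1, any
      \<open>t\<close> below 1/2 gives a contradiction.\<close>
    obtain u v where uv: "supports u v 1 (1/4)"
      by (rule supports_exists[of "1/4"]) auto
    have "a * (4 * u - v) = 0"
      using eq[OF _ _ uv] by (simp add: b0 power2_eq_square algebra_simps)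
    then have "u = v / 4"
      using ab b0 by simp
    then show False
      using supports_eq[OF uv] supportsD[OF uv, of 0 1] abs_fst_le[of 1 "1/4"] by (simp add: axes)
  qed
  define \<beta> where "\<beta> = a / b"
  define h where "h t = 1 + 2 * \<beta> * t\<^sup>2 + t ^ 4" for t
  have a: "a = \<beta> * b"
    using b by (simp add: \<beta>_def)
  have key: "g t * (\<beta> * t + t ^ 3) = v * h t" if "0 < t" "t < 1" "supports u v 1 t" for u v t
  proof -
    have "b * (u * (\<beta> * t + t ^ 3)) = b * (v * (1 + \<beta> * t\<^sup>2))"
      using eq[OF that] by (simp add: a algebra_simps)
    then have "u * (\<beta> * t + t ^ 3) = v * (1 + \<beta> * t\<^sup>2)"
      using b by simp
    moreover have "g t = u + v * t"
      using supports_eq[OF that(3)] by (simp add: g_def)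
    ultimately show ?thesis
      by (simp add: h_def algebra_simps power2_eq_square power3_eq_cube power4_eq_xxxx)
  qed
  have g1: "g t \<ge> 1" for t
    using abs_fst_le[of 1 t] by (simp add: g_def)
  have h: "h t \<noteq> 0" if t: "0 < t" "t < 1" for t
  proof
    assume h0: "h t = 0"
    obtain u v where "supports u v 1 t"
      using supports_exists[OF t(1)] by blast
    then have "\<beta> * t + t ^ 3 = 0"
      using key[OF t] h0 g1[of t] by simp
    then have "t * (\<beta> + t\<^sup>2) = 0"
      by (simp add: algebra_simps power2_eq_square power3_eq_cube)
    then have "\<beta> = - t\<^sup>2"
      using t by (simp add: add_eq_0_iff2)
    then have "t ^ 4 = 1"
      using h0 by (simp add: h_def power2_eq_square power4_eq_xxxx)
    then show False
      using t power_less_one_iff[of t 4] by simp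
  qed
  \<comment> \<open>By \<open>key\<close>, every support pair at \<open>(1, t)\<close> has this
    slope, which is continuous in \<open>t\<close>.\<close>
  define V where "V t = g t * (\<beta> * t + t ^ 3) / h t" for t
  have tangent: "V t * (s - t) \<le> g s - g t" if t: "0 < t" "t < 1" for s t
  proof -
    obtain u v where uv: "supports u v 1 t"
      using supports_exists[OF t(1)] by blast
    have "V t = v"
      using key[OF t uv] h[OF t] by (simp add: V_def)
    then show ?thesis
      using supportsD[OF uv, of 1 s] supports_eq[OF uv] by (simp add: g_def algebra_simps)
  qed
  have lip: "\<bar>g s - g t\<bar> \<le> \<bar>s - t\<bar>" for s t
    using triangle'[of 1 0 t "s - t"] triangle'[of 1 0 s "t - s"] by (simp add: g_def axes)
  have "continuous_on UNIV g"
    by (rule lipschitz_on_continuous_on[of 1]) (auto intro!: lipschitz_onI simp: dist_real_def lip)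
  then have cont_g: "isCont g t" for t
    by (simp add: continuous_on_eq_continuous_at)
  have cont_h: "isCont h t" for t
    unfolding h_def by (intro continuous_intros)
  \<comment> \<open>The tangent inequalities at \<open>s\<close> and at \<open>t\<close> trap the
    difference quotient between \<open>V t\<close> and \<open>V s\<close>.\<close>
  have deriv_g: "(g has_real_derivative V t) (at t)" if t: "0 < t" "t < 1" for t
    unfolding has_field_derivative_iff
  proof (rule LIM_zero_cancel, rule Lim_null_comparison)
    have "isCont V t"
      unfolding V_def using h[OF t] by (intro continuous_intros cont_g cont_h) auto
    then show "((\<lambda>s. \<bar>V s - V t\<bar>) \<longlongrightarrow> 0) (at t)"
      by (intro tendsto_rabs_zero LIM_zero) (simp add: isCont_def)
    have "\<forall>\<^sub>F s in at t. 0 < s \<and> s < 1 \<and> s \<noteq> t"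
      using t eventually_at_in_open[of "{0<..<1}" t] by simp
    then show "\<forall>\<^sub>F s in at t. norm ((g s - g t) / (s - t) - V t) \<le> \<bar>V s - V t\<bar>"
    proof eventually_elim
      case (elim s)
      have "V t * (s - t) \<le> g s - g t" "g s - g t \<le> V s * (s - t)"
        using tangent[OF t, of s] tangent[of s t] elim by (simp_all add: algebra_simps)
      then have "\<bar>(g s - g t) - V t * (s - t)\<bar> \<le> \<bar>(V s - V t) * (s - t)\<bar>"
        by (simp add: algebra_simps)
      moreover have "(g s - g t) / (s - t) - V t = ((g s - g t) - V t * (s - t)) / (s - t)"
        using elim by (simp add: field_simps)
      ultimately show ?case
        using elim by (simp add: abs_mult divide_le_eq)
    qed
  qed
  have below_1: "g t ^ 4 = h t" if t: "0 \<le> t" "t < 1" for t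
  proof (cases "t = 0")
    case True
    then show ?thesis by (simp add: g_def h_def axes)
  next
    case False
    have h': "h s \<noteq> 0" if "0 \<le> s" "s \<le> t" for s
      using h[of s] that t by (cases "s = 0") (auto simp: h_def)
    have "g t ^ 4 / h t = g 0 ^ 4 / h 0"
    proof (rule DERIV_isconst2[of 0 t])
      show "continuous_on {0..t} (\<lambda>s. g s ^ 4 / h s)"
        using h' cont_g cont_h
        by (intro continuous_intros continuous_at_imp_continuous_on) auto
      show "((\<lambda>s. g s ^ 4 / h s) has_real_derivative 0) (at s)" if s: "0 < s" "s < t" for s
      proof -
        have hs: "h s \<noteq> 0"
          using h' s by simp
        have "(h has_real_derivative 4 * (\<beta> * s + s ^ 3)) (at s)"
          unfolding h_def by (auto intro!: derivative_eq_intros simp: algebra_simps)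
        moreover have "(g has_real_derivative V s) (at s)"
          using deriv_g s t by simp
        ultimately show ?thesis
          using hs
          by (auto intro!: derivative_eq_intros
              simp: V_def field_simps power2_eq_square power3_eq_cube power4_eq_xxxx)
      qed
    qed (use False t in auto)
    then show ?thesis
      using h'[of t] t by (simp add: g_def h_def axes)
  qed
  \<comment> \<open>The support equation is available only for \<open>t < 1\<close>; the endpoint
    follows by continuity.\<close>
  have "g 1 ^ 4 - h 1 = 0"
  proof (rule tendsto_unique)
    show "((\<lambda>t. g t ^ 4 - h t) \<longlongrightarrow> g 1 ^ 4 - h 1) (at_left 1)"
      using cont_g[of 1] cont_h[of 1]
      by (intro tendsto_intros) (auto simp: isCont_def intro: filterlim_at_split[THEN iffD1, THEN conjunct1])
    have "\<forall>\<^sub>F t in at_left 1. (0::real) < t \<and> t < 1"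
      using eventually_at_left_real[of 0 1] by simp
    then show "((\<lambda>t. g t ^ 4 - h t) \<longlongrightarrow> 0) (at_left 1)"
      by (intro tendsto_eventually) (auto elim!: eventually_mono simp: below_1)
  qed simp
  then have "N (1, t) ^ 4 = 1 + 2 * \<beta> * t\<^sup>2 + t ^ 4" if "0 \<le> t" "t \<le> 1" for t
    using that below_1[of t] unfolding g_def h_def by (cases "t = 1") auto
  then show ?thesis by (rule that)
qed

section \<open>Extension to the plane and the range of \<beta>\<close>

lemma quartic_form:
  assumes "polynomial_numerical_index 3 N = 0"
  obtains \<beta> where "\<And>x y. N (x, y) ^ 4 = x ^ 4 + 2 * \<beta> * x\<^sup>2 * y\<^sup>2 + y ^ 4"
proof -
  obtain \<beta> where \<beta>: "\<And>t. 0 \<le> t \<Longrightarrow> t \<le> 1 \<Longrightarrow> N (1, t) ^ 4 = 1 + 2 * \<beta> * t\<^sup>2 + t ^ 4"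
    using profile_quartic[OF assms] by blast
  have le: "N (x, y) ^ 4 = x ^ 4 + 2 * \<beta> * x\<^sup>2 * y\<^sup>2 + y ^ 4" if "\<bar>y\<bar> \<le> \<bar>x\<bar>" for x y
  proof (cases "x = 0")
    case True
    then show ?thesis using that by (simp add: axes)
  next
    case False
    have "N (x, y) = \<bar>x\<bar> * N (1, \<bar>y\<bar> / \<bar>x\<bar>)"
      using scale'[of "\<bar>x\<bar>" 1 "\<bar>y\<bar> / \<bar>x\<bar>"] False by (simp add: abs_eq)
    then have "N (x, y) ^ 4 = x ^ 4 * (1 + 2 * \<beta> * (\<bar>y\<bar> / \<bar>x\<bar>)\<^sup>2 + (\<bar>y\<bar> / \<bar>x\<bar>) ^ 4)"
      using \<beta>[of "\<bar>y\<bar> / \<bar>x\<bar>"] that False by (simp add: power_mult_distrib)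
    also have "\<dots> = x ^ 4 + 2 * \<beta> * x\<^sup>2 * y\<^sup>2 + y ^ 4"
      using False by (simp add: power_divide field_simps power2_eq_square power4_eq_xxxx)
    finally show ?thesis .
  qed
  have "N (x, y) ^ 4 = x ^ 4 + 2 * \<beta> * x\<^sup>2 * y\<^sup>2 + y ^ 4" for x y
    using le[of y x] le[of x y] swap[of x y] by (cases "\<bar>y\<bar> \<le> \<bar>x\<bar>") (auto simp: algebra_simps)
  then show ?thesis by (rule that)
qed

lemma quartic_form_coefficient:
  assumes N4: "\<And>x y. N (x, y) ^ 4 = x ^ 4 + 2 * \<beta> * x\<^sup>2 * y\<^sup>2 + y ^ 4"
  shows "0 \<le> \<beta>" "\<beta> \<le> 3"
proof -
  show "0 \<le> \<beta>"
  proof (rule ccontr)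
    assume "\<not> 0 \<le> \<beta>"
    \<comment> \<open>This choice gives \<open>t^2 \<le> t \<le> -\<beta>\<close>, hence
      \<open>2 * \<beta> + t^2 \<le> \<beta> < 0\<close>.\<close>
    define t where "t = min 1 (- \<beta>)"
    have t: "0 < t" "t \<le> 1" "t \<le> - \<beta>"
      using \<open>\<not> 0 \<le> \<beta>\<close> by (auto simp: t_def)
    have "1 \<le> N (1, t) ^ 4"
      using abs_fst_le[of 1 t] by (simp add: one_le_power)
    then have "0 \<le> t\<^sup>2 * (2 * \<beta> + t\<^sup>2)"
      unfolding N4 by (simp add: algebra_simps power2_eq_square power4_eq_xxxx)
    then have "0 \<le> 2 * \<beta> + t\<^sup>2"
      using t by (simp add: zero_le_mult_iff)
    moreover have "t\<^sup>2 \<le> t"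
      using t by (simp add: power2_eq_square mult_left_le)
    ultimately show False
      using t by simp
  qed
  show "\<beta> \<le> 3"
  proof (rule ccontr)
    assume "\<not> \<beta> \<le> 3"
    \<comment> \<open>The fourth power of the norm at \<open>(1 + e, 1 - e)\<close> exceeds that at
      \<open>(1, 1)\<close> by a quadratic in \<open>e^2\<close>; this \<open>e^2\<close> is its
      minimizer, where it is negative.\<close>
    define e where "e = sqrt ((\<beta> - 3) / (\<beta> + 1))"
    have e: "e\<^sup>2 = (\<beta> - 3) / (\<beta> + 1)"
      using \<open>\<not> \<beta> \<le> 3\<close> by (simp add: e_def)
    have "2 * N (1, 1) \<le> N (1 + e, 1 - e) + N (1 - e, 1 + e)"
      using triangle'[of "1 + e" "1 - e" "1 - e" "1 + e"] scale'[of 2 1 1] by simp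
    then have "N (1, 1) ^ 4 \<le> N (1 + e, 1 - e) ^ 4"
      using swap[of "1 + e" "1 - e"] by (intro power_mono nonneg) simp
    then have "0 \<le> 2 * e\<^sup>2 * ((\<beta> + 1) * e\<^sup>2 - 2 * (\<beta> - 3))"
      unfolding N4 by (simp add: algebra_simps power2_eq_square power4_eq_xxxx)
    moreover have "(\<beta> + 1) * e\<^sup>2 - 2 * (\<beta> - 3) = - (\<beta> - 3)"
      using \<open>\<not> \<beta> \<le> 3\<close> by (simp add: e)
    moreover have "0 < e\<^sup>2"
      using \<open>\<not> \<beta> \<le> 3\<close> by (simp add: e)
    ultimately show False
      using \<open>\<not> \<beta> \<le> 3\<close> by (simp add: zero_le_mult_iff)
  qed
qed

end

theorem theorem2p10:
  fixes N :: "real \<times> real \<Rightarrow> real"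
  assumes "is_norm N"
    and "absolute_norm N"
    and "normalized_norm N"
    and "symmetric_norm N"
    and "polynomial_numerical_index 3 N = 0"
  shows "(\<exists>\<beta>\<in>{0..3}. \<forall>x y. N (x, y) = (x^4 + 2 * \<beta> * x^2 * y^2 + y^4) powr (1/4)) \<and>
         real_polynomial_function (\<lambda>p. N p ^ 4)"
proof -
  interpret symmetric_absolute_normalized N
    by unfold_locales (fact assms)+
  obtain \<beta> where \<beta>: "\<And>x y. N (x, y) ^ 4 = x ^ 4 + 2 * \<beta> * x\<^sup>2 * y\<^sup>2 + y ^ 4"
    using quartic_form[OF assms(5)] by blast
  \<comment> \<open>Nonnegativity of \<open>N\<close> makes the fourth root unambiguous; at zero
    both sides vanish.\<close>
  have "(N (x, y) ^ 4) powr (1/4) = N (x, y)" for x y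
  proof (cases "N (x, y) = 0")
    case False
    then have "N (x, y) > 0"
      using nonneg[of "(x, y)"] by simp
    then show ?thesis
      using powr_powr[of "N (x, y)" 4 "1/4"] by simp
  qed simp
  then have "\<forall>x y. N (x, y) = (x^4 + 2 * \<beta> * x^2 * y^2 + y^4) powr (1/4)"
    by (metis \<beta>)
  moreover have "(\<lambda>p. N p ^ 4) = (\<lambda>p. fst p ^ 4 + 2 * \<beta> * fst p ^ 2 * snd p ^ 2 + snd p ^ 4)"
    using \<beta> by auto
  then have "real_polynomial_function (\<lambda>p. N p ^ 4)"
    by (simp only:)
      (intro real_polynomial_function.intros real_polynomial_function_power
        bounded_linear_fst bounded_linear_snd)
  ultimately show ?thesis
    using quartic_form_coefficient[OF \<beta>] by auto
qed

end
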